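(* There exist an adaptive randomized algorithm and an adaptive deterministic algorithm that solve the Graph Reconstruction problem with a CC oracle using $\mathcal{O}(\Delta^2\log n)$ and $\mathcal{O}\big(\Delta^3\log(n/\Delta)\big)$ CC queries, respectively, where $n$ is the number of vertices and $\Delta$ the maximum degree of the hidden graph ($\Delta$ not given to the algorithms). The output of the randomized algorithm is correct with high probability.
   Context: Graph Reconstruction (GR): an unknown ("hidden") simple undirected graph $G=(V,E)$ on a known vertex set $V$ with $|V|=n$ is to be determined, i.e. the algorithm must output $E$. A CC oracle, on query $S\subseteq V$, returns the partition of $S$ into the vertex sets of the connected components of the induced subgraph $G[S]$; complexity is the number of queries. An adaptive algorithm may choose queries depending on earlier answers. "Correct with high probability" means the output equals the hidden graph with probability tending to $1$ as $n\to\infty$; a deterministic algorithm must always output the hidden graph. *)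

theory Defs
  imports "HOL-Probability.Probability"
begin

definition simple_graph :: "'a set \<Rightarrow> 'a set set \<Rightarrow> bool" where
  "simple_graph V E \<longleftrightarrow> finite V \<and> (\<forall>e\<in>E. e \<subseteq> V \<and> card e = 2)"

definition vertex_degree :: "'a set set \<Rightarrow> 'a \<Rightarrow> nat" where
  "vertex_degree E v = card {e \<in> E. v \<in> e}"

text \<open>Meaningful only for finite nonempty \<open>V\<close>, as it is a maximum over the vertices.\<close>

definition max_degree :: "'a set \<Rightarrow> 'a set set \<Rightarrow> nat" where
  "max_degree V E = Max (vertex_degree E ` V)"

definition induced_adj :: "'a set set \<Rightarrow> 'a set \<Rightarrow> ('a \<times> 'a) set" where
  "induced_adj E S = {(u, v). u \<in> S \<and> v \<in> S \<and> {u, v} \<in> E}"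

definition induced_connected :: "'a set set \<Rightarrow> 'a set \<Rightarrow> ('a \<times> 'a) set" where
  "induced_connected E S = {(u, v). u \<in> S \<and> v \<in> S \<and> (u, v) \<in> (induced_adj E S)\<^sup>*}"

definition cc_oracle :: "'a set set \<Rightarrow> 'a set \<Rightarrow> 'a set set" where
  "cc_oracle E S = S // induced_connected E S"

text \<open>
  A deterministic adaptive algorithm is a decision tree: it either stops and outputs an edge set,
  or queries a set and continues in a way that may depend on the answer. The hidden edge set \<open>E\<close> enters
  the execution only through the oracle. Since the datatype is well-founded, every execution
  terminates. A randomized algorithm is a probability distribution over such trees.
\<close>

datatype 'a cc_algorithm =
    Output "'a set set"
  | Query "'a set" "'a set set \<Rightarrow> 'a cc_algorithm"

primrec result :: "'a set set \<Rightarrow> 'a cc_algorithm \<Rightarrow> 'a set set" where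
  "result E (Output F) = F"
| "result E (Query S k) = result E (k (cc_oracle E S))"

primrec queries :: "'a set set \<Rightarrow> 'a cc_algorithm \<Rightarrow> 'a set list" where
  "queries E (Output F) = []"
| "queries E (Query S k) = S # queries E (k (cc_oracle E S))"

text \<open>
  Any algorithm that is always correct must query at least once on an edgeless graph with at least
  two vertices, so a bound that vanishes for maximum degree 0 is unattainable. The complexity
  bounds are therefore stated with \<open>max 1 \<Delta>\<close>, which equals \<open>\<Delta>\<close> as soon as there is an edge.
\<close>

definition degree_param :: "'a set \<Rightarrow> 'a set set \<Rightarrow> real" where
  "degree_param V E = real (max 1 (max_degree V E))"

end

theory Submission
  imports Defs
begin

text \<open>
  After some queries, keep as candidates all pairs that were never seen in different components;
  the candidate graph always contains the hidden graph. If \<open>S\<close> contains \<open>u\<close> but avoids its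
  neighbours \<open>N\<close>, then \<open>u\<close> is isolated in \<open>S\<close>, so every other vertex of \<open>S\<close> is separated from \<open>u\<close>.
  A random \<open>S\<close> of density about \<open>1 / d\<close> with \<open>card N \<le> d\<close> does this and meets a given set of
  \<open>k \<le> d\<close> further vertices with probability of order \<open>k / d\<^sup>2\<close>. A union bound over \<open>(u, N, W)\<close> with
  \<open>card W = k\<close> gives a fixed family of order \<open>(d\<^sup>3 / k) (1 + ln (n / d))\<close> queries after which, on every
  graph of maximum degree at most \<open>d\<close>, each vertex has fewer than \<open>k\<close> false candidates.

  With \<open>k = d\<close> this bounds the candidate degree by \<open>2 d\<close>. Hence doubling \<open>d\<close> until that bound is
  observed stops at \<open>d < 2 \<Delta>\<close> at the latest and certifies \<open>\<Delta> \<le> 2 d\<close>, with \<open>O(\<Delta>\<^sup>2 ln n)\<close>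
  queries. A final round for the certified degree bound is either the fixed family with \<open>k = 1\<close>, or
  \<open>O(\<Delta>\<^sup>2 ln n)\<close> random sets, where only the pairs of the one hidden graph enter the union bound.
\<close>

subsection \<open>Candidate edges\<close>

definition neighbours :: "'a set set \<Rightarrow> 'a \<Rightarrow> 'a set" where
  "neighbours E u = {w. {u, w} \<in> E}"

lemma neighbours_subset:
  assumes "simple_graph V E"
  shows "neighbours E u \<subseteq> V - {u}"
  using assms by (fastforce simp: neighbours_def simple_graph_def)

lemma card_neighbours:
  assumes "simple_graph V E"
  shows "card (neighbours E u) = vertex_degree E u"
  unfolding vertex_degree_def
proof (rule bij_betw_same_card)
  show "bij_betw (\<lambda>w. {u, w}) (neighbours E u) {e \<in> E. u \<in> e}"
    unfolding bij_betw_def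
  proof
    show "inj_on (\<lambda>w. {u, w}) (neighbours E u)"
      by (auto simp: inj_on_def doubleton_eq_iff)
    show "(\<lambda>w. {u, w}) ` neighbours E u = {e \<in> E. u \<in> e}"
    proof safe
      fix e assume e: "e \<in> E" "u \<in> e"
      then have "card e = 2" using assms by (simp add: simple_graph_def)
      with e obtain w where "e = {u, w}" by (auto simp: card_2_iff)
      with e show "e \<in> (\<lambda>w. {u, w}) ` neighbours E u" by (auto simp: neighbours_def)
    qed (auto simp: neighbours_def)
  qed
qed

lemma max_degree_ge:
  assumes "simple_graph V E" "u \<in> V"
  shows "card (neighbours E u) \<le> max_degree V E"
  using assms unfolding card_neighbours[OF assms(1)] max_degree_def
  by (intro Max_ge) (auto simp: simple_graph_def)

lemma max_degree_le_iff:
  assumes "simple_graph V E" "V \<noteq> {}"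
  shows "max_degree V E \<le> d \<longleftrightarrow> (\<forall>u\<in>V. card (neighbours E u) \<le> d)"
  using assms unfolding card_neighbours[OF assms(1)] max_degree_def
  by (subst Max_le_iff) (auto simp: simple_graph_def)

text \<open>A neighbourhood misses its own vertex. Strictness keeps \<open>ln (n / \<Delta>)\<close>
  positive, which the cubic query bound relies on.\<close>

lemma max_degree_less_card:
  assumes "simple_graph V E" "V \<noteq> {}"
  shows "max_degree V E < card V"
proof -
  have fin: "finite V" using assms by (simp add: simple_graph_def)
  have "card (neighbours E u) \<le> card V - 1" if "u \<in> V" for u
    using card_mono[OF _ neighbours_subset[OF assms(1)], of u] fin that by simp
  then have "max_degree V E \<le> card V - 1"
    using max_degree_le_iff[OF assms] by blast
  moreover have "card V > 0" using fin assms(2) by (simp add: card_gt_0_iff)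
  ultimately show ?thesis by linarith
qed

section \<open>Components reported by the oracle\<close>

lemma equiv_induced_connected: "equiv S (induced_connected E S)"
proof (rule equivI)
  have "sym (induced_adj E S)"
    by (auto simp: sym_def induced_adj_def insert_commute)
  then have "sym ((induced_adj E S)\<^sup>*)"
    by (rule sym_rtrancl)
  then show "sym (induced_connected E S)"
    by (auto simp: sym_def induced_connected_def)
  show "trans (induced_connected E S)"
    by (auto simp: trans_def induced_connected_def)
qed (auto simp: refl_on_def induced_connected_def)

lemma Union_cc_oracle: "\<Union> (cc_oracle E S) = S"
  unfolding cc_oracle_def by (rule Union_quotient[OF equiv_induced_connected])

lemma same_component_iff:
  "(\<exists>C\<in>cc_oracle E S. {u, v} \<subseteq> C) \<longleftrightarrow> (u, v) \<in> induced_connected E S"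
proof
  assume "\<exists>C\<in>cc_oracle E S. {u, v} \<subseteq> C"
  then show "(u, v) \<in> induced_connected E S"
    using in_quotient_imp_in_rel[OF equiv_induced_connected, of _ S E u v]
    by (auto simp: cc_oracle_def)
next
  assume *: "(u, v) \<in> induced_connected E S"
  then have "u \<in> S" by (auto simp: induced_connected_def)
  then have "induced_connected E S `` {u} \<in> cc_oracle E S"
    unfolding cc_oracle_def by (rule quotientI)
  moreover have "{u, v} \<subseteq> induced_connected E S `` {u}"
    using * \<open>u \<in> S\<close> by (auto simp: induced_connected_def)
  ultimately show "\<exists>C\<in>cc_oracle E S. {u, v} \<subseteq> C" by blast
qed

lemma edge_same_component:
  "\<lbrakk>{u, v} \<in> E; u \<in> S; v \<in> S\<rbrakk> \<Longrightarrow> (u, v) \<in> induced_connected E S"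
  by (auto simp: induced_connected_def induced_adj_def)

text \<open>A path of positive length from \<open>u\<close> would have to begin with an edge to a
  neighbour of \<open>u\<close> inside \<open>S\<close>.\<close>

lemma isolated_component:
  assumes "(u, v) \<in> induced_connected E S" "S \<inter> neighbours E u = {}"
  shows "u = v"
proof -
  have "(u, v) \<in> (induced_adj E S)\<^sup>*"
    using assms(1) by (simp add: induced_connected_def)
  then show ?thesis
  proof (cases rule: converse_rtranclE)
    case (step w)
    then show ?thesis using assms(2) by (auto simp: induced_adj_def neighbours_def)
  qed
qed

text \<open>Depends on the oracle answers alone, so an algorithm can evaluate it without knowing
  \<open>E\<close>. The queried set is recovered from an answer \<open>P\<close> as
  \<open>\<Union>P\<close>.\<close>

definition candidates :: "'a set \<Rightarrow> 'a set set list \<Rightarrow> 'a set set" where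
  "candidates V Ps = {{u, v} |u v. u \<in> V \<and> v \<in> V \<and> u \<noteq> v \<and>
     (\<forall>P\<in>set Ps. u \<in> \<Union>P \<longrightarrow> v \<in> \<Union>P \<longrightarrow> (\<exists>C\<in>P. {u, v} \<subseteq> C))}"

lemma simple_graph_candidates:
  assumes "finite V"
  shows "simple_graph V (candidates V Ps)"
  unfolding simple_graph_def
proof (intro conjI ballI)
  fix e assume "e \<in> candidates V Ps"
  then obtain u v where "e = {u, v}" "u \<in> V" "v \<in> V" "u \<noteq> v"
    unfolding candidates_def by blast
  then show "e \<subseteq> V" "card e = 2" by simp_all
qed (fact assms)

lemma candidates_iff:
  "{u, v} \<in> candidates V (map (cc_oracle E) Ss) \<longleftrightarrow> u \<in> V \<and> v \<in> V \<and> u \<noteq> v \<and>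
     (\<forall>S\<in>set Ss. u \<in> S \<longrightarrow> v \<in> S \<longrightarrow> (u, v) \<in> induced_connected E S)"
proof -
  have sym: "(u, v) \<in> induced_connected E S" if "(v, u) \<in> induced_connected E S" for S
    using that equiv_induced_connected[of S E] unfolding equiv_def sym_def by blast
  have "{u, v} \<in> candidates V (map (cc_oracle E) Ss) \<longleftrightarrow>
    (\<exists>x y. {u, v} = {x, y} \<and> x \<in> V \<and> y \<in> V \<and> x \<noteq> y \<and>
      (\<forall>S\<in>set Ss. x \<in> S \<longrightarrow> y \<in> S \<longrightarrow> (x, y) \<in> induced_connected E S))"
    by (simp add: candidates_def Union_cc_oracle same_component_iff del: Union_iff insert_subset)
  then show ?thesis
    unfolding doubleton_eq_iff using sym by blast
qed

lemma edges_subset_candidates: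
  assumes "simple_graph V E"
  shows "E \<subseteq> candidates V (map (cc_oracle E) Ss)"
proof
  fix e assume e: "e \<in> E"
  then have "e \<subseteq> V" "card e = 2" using assms by (auto simp: simple_graph_def)
  then obtain u v where "e = {u, v}" "u \<noteq> v" "u \<in> V" "v \<in> V" by (auto simp: card_2_iff)
  then show "e \<in> candidates V (map (cc_oracle E) Ss)"
    using e by (auto simp: candidates_iff edge_same_component)
qed

section \<open>Queries that separate a vertex from false candidates\<close>

definition hits :: "'a \<Rightarrow> 'a set \<Rightarrow> 'a set \<Rightarrow> 'a set set" where
  "hits u N W = {S. u \<in> S \<and> S \<inter> N = {} \<and> S \<inter> W \<noteq> {}}"

lemma hits_excludes_candidate:
  assumes "S \<in> set Ss" "S \<in> hits u (neighbours E u) W"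
    and "W \<subseteq> neighbours (candidates V (map (cc_oracle E) Ss)) u"
  shows False
proof -
  obtain v where v: "v \<in> S" "v \<in> W" and S: "u \<in> S" "S \<inter> neighbours E u = {}"
    using assms(2) by (auto simp: hits_def)
  then have "{u, v} \<in> candidates V (map (cc_oracle E) Ss)"
    using assms(3) by (auto simp: neighbours_def)
  then have "u \<noteq> v" "(u, v) \<in> induced_connected E S"
    using assms(1) v S by (auto simp: candidates_iff)
  with isolated_component S(2) show False by metis
qed

text \<open>\<open>N\<close> ranges over all conceivable neighbourhoods rather than those of one
  graph, so a family chosen from \<open>V\<close> and \<open>d\<close> alone can serve every hidden
  graph.\<close>

definition configurations :: "'a set \<Rightarrow> nat \<Rightarrow> nat \<Rightarrow> ('a \<times> 'a set \<times> 'a set) set" where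
  "configurations V d k = {(u, N, W). u \<in> V \<and> N \<subseteq> V \<and> W \<subseteq> V \<and> card N \<le> d \<and> card W = k \<and>
     u \<notin> N \<union> W \<and> N \<inter> W = {}}"

definition splitting :: "'a set \<Rightarrow> nat \<Rightarrow> nat \<Rightarrow> 'a set list \<Rightarrow> bool" where
  "splitting V d k Ss \<longleftrightarrow> (\<forall>(u, N, W)\<in>configurations V d k. \<exists>S\<in>set Ss. S \<in> hits u N W)"

text \<open>Any \<open>k\<close> false candidates of \<open>u\<close> would form a set
  \<open>W\<close> that some query hits, and a hit removes a member of \<open>W\<close> from the
  candidates.\<close>

lemma few_false_candidates:
  assumes G: "simple_graph V E" and "splitting V d k Ss" "max_degree V E \<le> d" "u \<in> V"
  shows "card (neighbours (candidates V (map (cc_oracle E) Ss)) u - neighbours E u) < k"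
proof (rule ccontr)
  let ?C = "candidates V (map (cc_oracle E) Ss)"
  have fin: "finite V" using G by (simp add: simple_graph_def)
  assume "\<not> ?thesis"
  then obtain W where W: "W \<subseteq> neighbours ?C u - neighbours E u" "card W = k"
    by (meson not_less obtain_subset_with_card_n)
  moreover have "neighbours ?C u \<subseteq> V - {u}"
    using neighbours_subset[OF simple_graph_candidates[OF fin]] .
  moreover have "neighbours E u \<subseteq> V - {u}" "card (neighbours E u) \<le> d"
    using neighbours_subset[OF G] max_degree_ge[OF G] assms(3,4) by (blast, force)
  ultimately have "(u, neighbours E u, W) \<in> configurations V d k"
    using assms(4) unfolding configurations_def by blast
  then obtain S where "S \<in> set Ss" "S \<in> hits u (neighbours E u) W"
    using assms(2) by (auto simp: splitting_def)
  with hits_excludes_candidate W(1) show False by (metis Diff_subset subset_trans)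
qed

text \<open>Neighbourhoods only grow when passing to candidates, whatever was queried. The
  observable candidate degree is therefore always a safe upper bound.\<close>

lemma max_degree_candidates_ge:
  assumes G: "simple_graph V E" and "V \<noteq> {}"
  shows "max_degree V E \<le> max_degree V (candidates V (map (cc_oracle E) Ss))"
proof -
  let ?C = "candidates V (map (cc_oracle E) Ss)"
  have fin: "finite V" using G by (simp add: simple_graph_def)
  have sub: "neighbours ?C u \<subseteq> V" for u
    using neighbours_subset[OF simple_graph_candidates[OF fin]] by fastforce
  have "card (neighbours E u) \<le> max_degree V ?C" if "u \<in> V" for u
  proof -
    have "card (neighbours E u) \<le> card (neighbours ?C u)"
      using edges_subset_candidates[OF G, of Ss] finite_subset[OF sub fin]
      by (intro card_mono) (auto simp: neighbours_def)
    also have "\<dots> \<le> max_degree V ?C"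
      using max_degree_ge[OF simple_graph_candidates[OF fin] that] .
    finally show ?thesis .
  qed
  then show ?thesis using max_degree_le_iff[OF assms] by blast
qed

text \<open>At most \<open>d\<close> true neighbours plus fewer than \<open>k\<close> false ones. It
  is used contrapositively: a larger candidate degree proves that the hidden degree exceeds
  \<open>d\<close>.\<close>

lemma max_degree_candidates_le:
  assumes G: "simple_graph V E" and "V \<noteq> {}" "splitting V d k Ss" "max_degree V E \<le> d"
  shows "max_degree V (candidates V (map (cc_oracle E) Ss)) \<le> d + k"
proof -
  let ?C = "candidates V (map (cc_oracle E) Ss)"
  have fin: "finite V" using G by (simp add: simple_graph_def)
  have "card (neighbours ?C u) \<le> d + k" if u: "u \<in> V" for u
  proof -
    have "finite (neighbours E u)"
      using neighbours_subset[OF G] fin by (meson finite_Diff finite_subset)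
    then have "card (neighbours ?C u) \<le> card (neighbours ?C u - neighbours E u) + card (neighbours E u)"
      by (metis card_Diff_subset_Int diff_card_le_card_Diff le_diff_conv)
    then show ?thesis
      using few_false_candidates[OF G assms(3,4) u] max_degree_ge[OF G u] assms(4) by linarith
  qed
  then show ?thesis
    using max_degree_le_iff[OF simple_graph_candidates[OF fin] assms(2)] by blast
qed

text \<open>Only the actual neighbourhoods occur in the hypothesis, so both the fixed family with
  \<open>k = 1\<close> and a random sample for one graph can supply it.\<close>

lemma candidates_eq_edges:
  assumes G: "simple_graph V E"
    and sep: "\<And>u v. \<lbrakk>u \<in> V; v \<in> V; u \<noteq> v; {u, v} \<notin> E\<rbrakk>
      \<Longrightarrow> \<exists>S\<in>set Ss. S \<in> hits u (neighbours E u) {v}"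
  shows "candidates V (map (cc_oracle E) Ss) = E"
proof
  show "candidates V (map (cc_oracle E) Ss) \<subseteq> E"
  proof
    fix e assume e: "e \<in> candidates V (map (cc_oracle E) Ss)"
    then obtain u v where uv: "e = {u, v}" "u \<in> V" "v \<in> V" "u \<noteq> v"
      unfolding candidates_def by blast
    then have "{v} \<subseteq> neighbours (candidates V (map (cc_oracle E) Ss)) u"
      using e uv(1) by (simp add: neighbours_def)
    then show "e \<in> E"
      using sep[OF uv(2-4)] hits_excludes_candidate uv(1) by metis
  qed
qed (rule edges_subset_candidates[OF G])

lemma splitting_one_candidates:
  assumes G: "simple_graph V E" and "splitting V d 1 Ss" "max_degree V E \<le> d"
  shows "candidates V (map (cc_oracle E) Ss) = E"
proof (rule candidates_eq_edges[OF G])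
  fix u v assume *: "u \<in> V" "v \<in> V" "u \<noteq> v" "{u, v} \<notin> E"
  moreover have "neighbours E u \<subseteq> V - {u}" "card (neighbours E u) \<le> d" "v \<notin> neighbours E u"
    using neighbours_subset[OF G] max_degree_ge[OF G, of u] assms(3) * by (auto simp: neighbours_def)
  ultimately have "(u, neighbours E u, {v}) \<in> configurations V d 1"
    unfolding configurations_def by auto
  then show "\<exists>S\<in>set Ss. S \<in> hits u (neighbours E u) {v}"
    using assms(2) by (auto simp: splitting_def)
qed

subsection \<open>Certifying the maximum degree\<close>

text \<open>A nonadaptive batch in continuation style: \<open>K\<close> receives the answers in
  query order.\<close>

primrec ask :: "'a set list \<Rightarrow> ('a set set list \<Rightarrow> 'a cc_algorithm) \<Rightarrow> 'a cc_algorithm" where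
  "ask [] K = K []"
| "ask (S # Ss) K = Query S (\<lambda>P. ask Ss (\<lambda>Ps. K (P # Ps)))"

lemma result_ask: "result E (ask Ss K) = result E (K (map (cc_oracle E) Ss))"
  by (induction Ss arbitrary: K) auto

lemma queries_ask: "queries E (ask Ss K) = Ss @ queries E (K (map (cc_oracle E) Ss))"
  by (induction Ss arbitrary: K) auto

text \<open>The fuel \<open>f\<close> bounds the number of doublings and makes the recursion
  primitive. When it runs out, \<open>2 * d\<close> is passed on untested, so \<open>f\<close> has
  to be large enough.\<close>

primrec estimate :: "'a set \<Rightarrow> (nat \<Rightarrow> 'a set list) \<Rightarrow> nat \<Rightarrow> nat \<Rightarrow> (nat \<Rightarrow> 'a cc_algorithm) \<Rightarrow> 'a cc_algorithm" where
  "estimate V F 0 d K = K (2 * d)"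
| "estimate V F (Suc f) d K = ask (F d) (\<lambda>Ps.
     if max_degree V (candidates V Ps) \<le> 2 * d then K (2 * d) else estimate V F f (2 * d) K)"

text \<open>Both length bounds are potentials: doubling \<open>d\<close> lowers them by exactly
  \<open>a * d ^ 2\<close> and \<open>b * d\<close>, the cost allowed for one round. The premise
  \<open>M \<le> 2 ^ f * d\<close> keeps the fuel sufficient. As \<open>D\<close> and
  \<open>Q\<close> do not depend on \<open>K\<close>, any final round can be attached.\<close>

lemma estimate_correct:
  fixes a b :: real
  assumes G: "simple_graph V E" "V \<noteq> {}"
    and F: "\<And>d. d \<ge> 1 \<Longrightarrow> splitting V d d (F d) \<and> (\<forall>S\<in>set (F d). S \<subseteq> V) \<and>
      real (length (F d)) \<le> a * real d ^ 2 \<and> real (length (F d)) \<le> b * real d"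
    and "a \<ge> 0" "b \<ge> 0"
    and M: "M = max 1 (max_degree V E)"
    and D: "M \<le> 2 ^ f * d" "d \<ge> 1" "d \<le> 2 * M"
  shows "\<exists>D Q. M \<le> D \<and> D \<le> 4 * M \<and> (\<forall>S\<in>set Q. S \<subseteq> V) \<and>
    real (length Q) \<le> a * (16 * real M ^ 2 - real d ^ 2) / 3 \<and> real (length Q) \<le> b * (4 * real M - real d) \<and>
    (\<forall>K. result E (estimate V F f d K) = result E (K D) \<and>
      queries E (estimate V F f d K) = Q @ queries E (K D))"
  using D
proof (induction f arbitrary: d)
  case 0
  have "real d ^ 2 \<le> (4 * real M) ^ 2" using 0 by (intro power_mono) auto
  moreover have "real d \<le> 4 * real M" using 0 by simp
  ultimately have "a * (16 * real M ^ 2 - real d ^ 2) / 3 \<ge> 0" "b * (4 * real M - real d) \<ge> 0"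
    using \<open>a \<ge> 0\<close> \<open>b \<ge> 0\<close> by (auto intro!: mult_nonneg_nonneg)
  with 0 show ?case by (intro exI[of _ "2 * d"] exI[of _ "[]"]) auto
next
  case (Suc f)
  let ?C = "candidates V (map (cc_oracle E) (F d))"
  note Fd = F[OF Suc.prems(2)]
  show ?case
  proof (cases "max_degree V ?C \<le> 2 * d")
    case True
    then have "M \<le> 2 * d"
      using max_degree_candidates_ge[OF G, of "F d"] True Suc.prems(2) M by simp
    \<comment> \<open>The last round must fit into the remaining potential:
      \<open>d ^ 2 \<le> (16 * M ^ 2 - d ^ 2) / 3\<close> and \<open>d \<le> 4 * M - d\<close> both
      say exactly \<open>d \<le> 2 * M\<close>.\<close>
    have "real d ^ 2 \<le> (2 * real M) ^ 2" using Suc.prems(3) by (intro power_mono) auto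
    moreover have "real d \<le> 2 * real M" using Suc.prems(3) by simp
    ultimately have "a * real d ^ 2 \<le> a * (2 * real M) ^ 2" "b * real d \<le> b * (2 * real M)"
      using \<open>a \<ge> 0\<close> \<open>b \<ge> 0\<close> by (meson mult_left_mono)+
    then have "a * real d ^ 2 \<le> a * (16 * real M ^ 2 - real d ^ 2) / 3" "b * real d \<le> b * (4 * real M - real d)"
      by (simp_all add: algebra_simps)
    then have "real (length (F d)) \<le> a * (16 * real M ^ 2 - real d ^ 2) / 3" "real (length (F d)) \<le> b * (4 * real M - real d)"
      using Fd by linarith+
    then show ?thesis
      using True \<open>M \<le> 2 * d\<close> Suc.prems Fd
      by (intro exI[of _ "2 * d"] exI[of _ "F d"]) (auto simp: result_ask queries_ask)
  next
    case False
    \<comment> \<open>A failed test shows \<open>d < M\<close>, which preserves the invariant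
      \<open>2 * d \<le> 2 * M\<close> for the next round.\<close>
    then have "\<not> max_degree V E \<le> d"
      using max_degree_candidates_le[OF G, of d d "F d"] Fd by auto
    then have "M \<le> 2 ^ f * (2 * d)" "1 \<le> 2 * d" "2 * d \<le> 2 * M"
      using M Suc.prems by (auto simp: mult_ac)
    from Suc.IH[OF this] obtain D Q where DQ: "M \<le> D" "D \<le> 4 * M" "\<forall>S\<in>set Q. S \<subseteq> V"
      and len: "real (length Q) \<le> a * (16 * real M ^ 2 - real (2 * d) ^ 2) / 3"
        "real (length Q) \<le> b * (4 * real M - real (2 * d))"
      and run: "\<And>K. result E (estimate V F f (2 * d) K) = result E (K D)"
        "\<And>K. queries E (estimate V F f (2 * d) K) = Q @ queries E (K D)"
      by blast
    show ?thesis
    proof (intro exI conjI allI)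
      show "\<forall>S\<in>set (F d @ Q). S \<subseteq> V" using DQ Fd by auto
      show "real (length (F d @ Q)) \<le> a * (16 * real M ^ 2 - real d ^ 2) / 3"
        using Fd len(1) by (simp add: algebra_simps)
      show "real (length (F d @ Q)) \<le> b * (4 * real M - real d)"
        using Fd len(2) by (simp add: algebra_simps)
    qed (use False DQ run in \<open>simp_all add: result_ask queries_ask\<close>)
  qed
qed

subsection \<open>Random queries\<close>

definition random_subset :: "'a set \<Rightarrow> real \<Rightarrow> 'a set pmf" where
  "random_subset V p = map_pmf (\<lambda>f. {v. f v}) (Pi_pmf V False (\<lambda>_. bernoulli_pmf p))"

lemma set_random_subset:
  assumes "finite V" "S \<in> set_pmf (random_subset V p)"
  shows "S \<subseteq> V"
proof
  fix x assume x: "x \<in> S"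
  obtain f where f: "f \<in> set_pmf (Pi_pmf V False (\<lambda>_. bernoulli_pmf p))" "S = {v. f v}"
    using assms(2) by (auto simp: random_subset_def)
  have "\<forall>x. x \<notin> V \<longrightarrow> f x = False"
    using subsetD[OF set_Pi_pmf_subset[OF assms(1)] f(1)] by simp
  moreover have "f x" using x f(2) by simp
  ultimately show "x \<in> V" by blast
qed

lemma prob_random_subset_avoids:
  assumes "finite V" "u \<in> V" "N \<subseteq> V" "u \<notin> N" "0 \<le> p" "p \<le> 1"
  shows "measure_pmf.prob (random_subset V p) {S. u \<in> S \<and> S \<inter> N = {}} = p * (1 - p) ^ card N"
proof -
  \<comment> \<open>The event is a product of constraints on single coordinates; the coordinates
    outside \<open>insert u N\<close> contribute the factor 1.\<close>
  let ?B = "\<lambda>x. if x = u then {True} else if x \<in> N then {False} else UNIV"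
  let ?q = "\<lambda>x. measure_pmf.prob (bernoulli_pmf p) (?B x)"
  have finN: "finite N" using assms(1,3) by (rule rev_finite_subset)
  have "(\<lambda>f. {v. f v}) -` {S. u \<in> S \<and> S \<inter> N = {}} = Pi V ?B"
  proof (intro set_eqI iffI)
    fix f assume "f \<in> Pi V ?B"
    then have f: "f x \<in> ?B x" if "x \<in> V" for x using that by (rule Pi_mem)
    have "f u" using f[OF assms(2)] by simp
    moreover have "\<not> f x" if "x \<in> N" for x
    proof -
      have "x \<in> V" "x \<noteq> u" using that assms(3,4) by auto
      then show ?thesis using f[of x] that by simp
    qed
    ultimately show "f \<in> (\<lambda>f. {v. f v}) -` {S. u \<in> S \<and> S \<inter> N = {}}" by auto
  qed (auto split: if_splits)
  then have "measure_pmf.prob (random_subset V p) {S. u \<in> S \<and> S \<inter> N = {}} = (\<Prod>x\<in>V. ?q x)"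
    by (simp add: random_subset_def measure_map_pmf measure_Pi_pmf_Pi assms(1))
  also have "\<dots> = (\<Prod>x\<in>insert u N. ?q x)"
    using assms by (intro prod.mono_neutral_right) auto
  also have "\<dots> = ?q u * (\<Prod>x\<in>N. ?q x)"
    using assms(4) finN by (subst prod.insert) auto
  also have "(\<Prod>x\<in>N. ?q x) = (\<Prod>x\<in>N. 1 - p)"
    using assms by (intro prod.cong) (auto simp: measure_pmf_single)
  finally show ?thesis using assms by (simp add: measure_pmf_single)
qed

lemma prob_random_subset_hits:
  assumes "finite V" "u \<in> V" "N \<subseteq> V" "W \<subseteq> V" "u \<notin> N \<union> W" "N \<inter> W = {}" "0 \<le> p" "p \<le> 1"
  shows "measure_pmf.prob (random_subset V p) (hits u N W)
    = p * (1 - p) ^ card N * (1 - (1 - p) ^ card W)"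
proof -
  let ?P = "measure_pmf.prob (random_subset V p)"
  \<comment> \<open>Meeting \<open>W\<close> is the complement of avoiding it, so two avoidance
    probabilities suffice.\<close>
  have "hits u N W = {S. u \<in> S \<and> S \<inter> N = {}} - {S. u \<in> S \<and> S \<inter> (N \<union> W) = {}}"
    by (auto simp: hits_def)
  then have "?P (hits u N W) = ?P {S. u \<in> S \<and> S \<inter> N = {}} - ?P {S. u \<in> S \<and> S \<inter> (N \<union> W) = {}}"
    by (simp add: measure_pmf.finite_measure_Diff[symmetric] Collect_mono subset_iff disjoint_iff)
  moreover have "card (N \<union> W) = card N + card W"
    using assms by (meson card_Un_disjoint finite_subset)
  ultimately show ?thesis
    using assms by (simp add: prob_random_subset_avoids power_add algebra_simps)
qed

text \<open>Density \<open>1 / (d + 1)\<close> rather than \<open>1 / d\<close> makes the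
  complementary probability the inverse of \<open>1 + 1 / d\<close>, whose \<open>d\<close>-th power
  is at most \<open>exp 1\<close>; it also stays positive at \<open>d = 1\<close>.\<close>

definition sample_subset :: "'a set \<Rightarrow> nat \<Rightarrow> 'a set pmf" where
  "sample_subset V d = random_subset V (1 / (real d + 1))"

lemma prob_sample_subset_hits:
  assumes "finite V" "(u, N, W) \<in> configurations V d k" "k \<le> d" "1 \<le> d"
  shows "measure_pmf.prob (sample_subset V d) (hits u N W) \<ge> k / (24 * real d ^ 2)"
proof -
  define p where "p = 1 / (real d + 1)"
  have p: "0 < p" "p \<le> 1" "p \<ge> 1 / (2 * d)" using assms(4) by (auto simp: p_def field_simps)
  have c: "u \<in> V" "N \<subseteq> V" "W \<subseteq> V" "u \<notin> N \<union> W" "N \<inter> W = {}" "card N \<le> d" "card W = k"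
    using assms(2) by (auto simp: configurations_def)
  have "(1 + 1 / real d) ^ d \<le> exp 1"
    using exp_ge_one_plus_x_over_n_power_n[of d 1] assms(4) by simp
  then have e: "(1 + 1 / real d) ^ d \<le> 3" using exp_le by linarith
  have inv: "1 - p = inverse (1 + 1 / real d)" using assms(4) by (simp add: p_def field_simps)
  have "1 / 3 \<le> (1 - p) ^ d"
    using e unfolding inv power_inverse
    using le_imp_inverse_le[of "(1 + 1 / real d) ^ d" 3] by (simp add: add_pos_nonneg inverse_eq_divide)
  also have "\<dots> \<le> (1 - p) ^ card N"
    using c p by (intro power_decreasing) auto
  finally have A: "1 / 3 \<le> (1 - p) ^ card N" .
  \<comment> \<open>Bernoulli's inequality bounds the chance of missing \<open>W\<close> by
    \<open>d / (d + k)\<close>; then \<open>k \<le> d\<close> gives the factor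
    \<open>k / (2 * d)\<close>.\<close>
  have "1 + k / real d \<le> (1 + 1 / real d) ^ k"
    using Bernoulli_inequality[of "1 / real d" k] order_trans[of "- 1" 0 "1 / real d"] by simp
  then have "(1 - p) ^ k \<le> inverse (1 + k / real d)"
    unfolding inv power_inverse by (intro le_imp_inverse_le) (auto intro: add_pos_nonneg)
  also have "\<dots> = real d / (real d + k)" using assms(4) by (simp add: field_simps)
  also have "\<dots> = 1 - k / (real d + k)" using assms(4) by (simp add: field_simps)
  also have "\<dots> \<le> 1 - k / (2 * d)"
    using assms(3,4) by (auto intro!: divide_left_mono)
  finally have B: "k / (2 * d) \<le> 1 - (1 - p) ^ card W" using c by simp
  \<comment> \<open>The three factors multiply to \<open>k / (12 * d ^ 2)\<close>, so 24 leaves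
    slack.\<close>
  have "k / (24 * real d ^ 2) \<le> (1 / (2 * d)) * (1 / 3) * (k / (2 * d))"
    using assms(4) by (simp add: power2_eq_square field_simps)
  also have "\<dots> \<le> p * (1 - p) ^ card N * (1 - (1 - p) ^ card W)"
    using p A B by (intro mult_mono) auto
  also have "\<dots> = measure_pmf.prob (sample_subset V d) (hits u N W)"
    unfolding sample_subset_def p_def[symmetric]
    using prob_random_subset_hits[OF assms(1) c(1-5)] p by simp
  finally show ?thesis .
qed

definition sample_list :: "'a set \<Rightarrow> nat \<Rightarrow> nat \<Rightarrow> 'a set list pmf" where
  "sample_list V d m = map_pmf (\<lambda>f. map f [0..<m]) (Pi_pmf {..<m} {} (\<lambda>_. sample_subset V d))"

lemma length_sample_list: "Ss \<in> set_pmf (sample_list V d m) \<Longrightarrow> length Ss = m"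
  by (auto simp: sample_list_def)

lemma set_sample_list:
  assumes "finite V" "Ss \<in> set_pmf (sample_list V d m)" "S \<in> set Ss"
  shows "S \<subseteq> V"
proof -
  obtain f i where f: "f \<in> set_pmf (Pi_pmf {..<m} {} (\<lambda>_. sample_subset V d))" "i < m" "S = f i"
    using assms(2,3) by (auto simp: sample_list_def)
  then have "S \<in> set_pmf (sample_subset V d)"
    by (auto simp: set_Pi_pmf PiE_dflt_def)
  then show ?thesis using set_random_subset[OF assms(1)] by (simp add: sample_subset_def)
qed

lemma prob_sample_list_all:
  "measure_pmf.prob (sample_list V d m) {Ss. \<forall>S\<in>set Ss. S \<in> B}
    = measure_pmf.prob (sample_subset V d) B ^ m"
proof -
  have "(\<lambda>f. map f [0..<m]) -` {Ss. \<forall>S\<in>set Ss. S \<in> B} = Pi {..<m} (\<lambda>_. B)"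
    by (auto simp: Pi_def)
  then show ?thesis
    by (simp add: sample_list_def measure_map_pmf measure_Pi_pmf_Pi)
qed

text \<open>Union bound over \<open>I\<close>, with \<open>(1 - q) ^ m \<le> exp (- m * q)\<close>
  for each member. The set \<open>I\<close> is left free: all configurations for the fixed families,
  the non-edges of a single graph for the random round.\<close>

lemma prob_sample_list_misses:
  assumes V: "finite V" and c: "I \<subseteq> configurations V d k" and "finite I" "k \<le> d" "1 \<le> d"
  shows "measure_pmf.prob (sample_list V d m) {Ss. \<exists>(u, N, W)\<in>I. \<forall>S\<in>set Ss. S \<notin> hits u N W}
    \<le> card I * exp (- (m * (k / (24 * real d ^ 2))))"
proof -
  let ?P = "measure_pmf.prob (sample_list V d m)"
  let ?q = "k / (24 * real d ^ 2)"
  let ?B = "\<lambda>(u, N, W). {Ss. \<forall>S\<in>set Ss. S \<in> - hits u N W}"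
  have "?P (?B x) \<le> exp (- (m * ?q))" if x: "x \<in> I" for x
  proof -
    obtain u N W where x_eq: "x = (u, N, W)" by (cases x)
    let ?h = "measure_pmf.prob (sample_subset V d) (- hits u N W)"
    have "?h = 1 - measure_pmf.prob (sample_subset V d) (hits u N W)"
      using measure_pmf.prob_compl[of "hits u N W" "sample_subset V d"] by (simp add: Compl_eq_Diff_UNIV)
    also have "\<dots> \<le> 1 - ?q"
      using prob_sample_subset_hits[OF V _ assms(4,5)] c x x_eq by auto
    also have "\<dots> \<le> exp (- ?q)"
      using exp_ge_add_one_self[of "- ?q"] by simp
    finally have "?h ^ m \<le> exp (- ?q) ^ m" by (intro power_mono) auto
    then show ?thesis
      by (simp only: x_eq prod.case prob_sample_list_all) (simp add: exp_of_nat_mult[symmetric])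
  qed
  then have "(\<Sum>x\<in>I. ?P (?B x)) \<le> card I * exp (- (m * ?q))"
    by (intro sum_bounded_above) 
  moreover have "{Ss. \<exists>(u, N, W)\<in>I. \<forall>S\<in>set Ss. S \<notin> hits u N W} = (\<Union>x\<in>I. ?B x)"
    by auto
  moreover have "?P (\<Union>x\<in>I. ?B x) \<le> (\<Sum>x\<in>I. ?P (?B x))"
    using assms(3) by (intro measure_pmf.finite_measure_subadditive_finite) auto
  ultimately show ?thesis by simp
qed

section \<open>Counting configurations and the probabilistic method\<close>

lemma card_small_subsets:
  assumes "finite V" "1 \<le> d" "d \<le> card V"
  shows "real (card {N. N \<subseteq> V \<and> card N \<le> d}) \<le> exp (d * (1 + ln (card V / d)))"
proof -
  let ?n = "card V"
  \<comment> \<open>weight \<open>N\<close> by \<open>x ^ card N\<close>, which is at least \<open>x ^ d\<close> on the sets counted\<close>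
  define x where "x = real d / ?n"
  have x: "0 < x" "x \<le> 1" using assms by (auto simp: x_def)
  let ?A = "{N. N \<subseteq> V \<and> card N \<le> d}"
  have "card ?A * x ^ d = (\<Sum>N\<in>?A. x ^ d)" by simp
  also have "\<dots> \<le> (\<Sum>N\<in>?A. x ^ card N)"
    using x by (intro sum_mono power_decreasing) auto
  also have "\<dots> \<le> (\<Sum>N\<in>Pow V. x ^ card N)"
    using assms x by (intro sum_mono2) auto
  also have "\<dots> = (\<Prod>v\<in>V. x + 1)"
    using prod_add[OF assms(1), of "\<lambda>_. x" "\<lambda>_. 1"] by simp
  also have "\<dots> = (1 + d / ?n) ^ ?n" by (simp add: x_def add.commute)
  also have "\<dots> \<le> exp d"
    using exp_ge_one_plus_x_over_n_power_n[of ?n "real d"] assms by simp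
  finally have "card ?A \<le> exp d / x ^ d" using x by (simp add: field_simps)
  also have "x ^ d = exp (d * ln x)" using x by (simp add: exp_of_nat_mult)
  also have "exp d / exp (d * ln x) = exp (d * (1 + ln (?n / d)))"
    using assms by (simp add: x_def ln_div exp_diff[symmetric] algebra_simps)
  finally show ?thesis .
qed

text \<open>The inequality \<open>ln (d / k) \<le> d / k - 1\<close> pays for the change of scale.
  It lets counts at the sizes 1 and \<open>k\<close> be measured by the count at size
  \<open>d\<close>.\<close>

lemma entropy_mono:
  fixes n :: real and k d :: nat
  assumes "1 \<le> k" "k \<le> d" "real d \<le> n"
  shows "k * (1 + ln (n / k)) \<le> d * (1 + ln (n / d))"
proof -
  have "ln (n / k) = ln (n / d) + ln (d / k)"
    using assms by (simp add: ln_div)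
  also have "\<dots> \<le> ln (n / d) + (d / k - 1)"
    using ln_le_minus_one[of "d / k"] assms by simp
  finally have "k * (1 + ln (n / k)) \<le> k * (ln (n / d) + d / k)"
    by (intro mult_left_mono) auto
  also have "\<dots> = k * ln (n / d) + d" using assms by (simp add: field_simps)
  also have "\<dots> \<le> d * ln (n / d) + d"
    using assms by (intro add_right_mono mult_right_mono) auto
  finally show ?thesis by (simp add: algebra_simps)
qed

text \<open>Each of the choices of \<open>u\<close>, \<open>N\<close> and \<open>W\<close> has at
  most \<open>(e * n / d) ^ d\<close> values, written as an exponential to meet the failure
  bound.\<close>

lemma card_configurations:
  assumes "finite V" "1 \<le> k" "k \<le> d" "d \<le> card V"
  shows "finite (configurations V d k)"
    and "real (card (configurations V d k)) \<le> exp (3 * (d * (1 + ln (card V / d))))"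
proof -
  let ?A = "\<lambda>d. {N. N \<subseteq> V \<and> card N \<le> d}"
  let ?h = "\<lambda>d. d * (1 + ln (card V / d))"
  have fin: "finite (?A i)" for i using assms(1) by (intro finite_subset[of "?A i" "Pow V"]) auto
  have sub: "configurations V d k \<subseteq> V \<times> ?A d \<times> ?A k"
    unfolding configurations_def by blast
  have fin': "finite (V \<times> ?A d \<times> ?A k)"
    using fin assms(1) by (intro finite_cartesian_product)
  show "finite (configurations V d k)"
    by (rule finite_subset[OF sub fin'])
  have "card (configurations V d k) \<le> card (V \<times> ?A d \<times> ?A k)"
    by (rule card_mono[OF fin' sub])
  then have "real (card (configurations V d k)) \<le> real (card V) * (real (card (?A d)) * real (card (?A k)))"
    unfolding card_cartesian_product of_nat_mult[symmetric] of_nat_le_iff .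
  also have "\<dots> \<le> exp (?h d) * (exp (?h d) * exp (?h d))"
  proof (intro mult_mono)
    \<comment> \<open>The vertex count is compared with the entropy bound at size 1.\<close>
    have "real (card V) = exp (ln (card V))" using assms by simp
    also have "\<dots> \<le> exp (1 * (1 + ln (card V / 1)))" by simp
    also have "\<dots> \<le> exp (?h d)"
      using entropy_mono[of 1 d "card V"] assms by simp
    finally show "real (card V) \<le> exp (?h d)" .
    show "real (card (?A d)) \<le> exp (?h d)"
      by (rule card_small_subsets) (use assms in linarith)+
    have "real (card (?A k)) \<le> exp (?h k)"
      by (rule card_small_subsets) (use assms in linarith)+
    also have "\<dots> \<le> exp (?h d)"
      using entropy_mono[of k d "card V"] assms by simp
    finally show "real (card (?A k)) \<le> exp (?h d)" .
  qed simp_all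
  also have "\<dots> = exp (3 * ?h d)" by (simp add: exp_add[symmetric])
  finally show "real (card (configurations V d k)) \<le> exp (3 * ?h d)" .
qed

text \<open>Probabilistic method: once \<open>m * k / (24 * d ^ 2)\<close> exceeds the exponent
  \<open>3 * d * (1 + ln (n / d))\<close> of the configuration count, a random list fails with
  probability below 1.\<close>

lemma splitting_exists:
  assumes "finite V" "1 \<le> k" "k \<le> d" "d \<le> card V"
  shows "\<exists>Ss. splitting V d k Ss \<and> (\<forall>S\<in>set Ss. S \<subseteq> V) \<and>
    real (length Ss) \<le> 73 * (real d ^ 3 / k) * (1 + ln (card V / d))"
proof -
  let ?L = "1 + ln (card V / d)"
  let ?x = "72 * (real d ^ 3 / k) * ?L"
  \<comment> \<open>Here 72 is 3 times 24. The successor makes \<open>m\<close> strictly larger than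
    \<open>?x\<close>; the extra query is absorbed in passing from 72 to 73.\<close>
  define m where "m = Suc (nat \<lfloor>?x\<rfloor>)"
  let ?I = "configurations V d k"
  let ?P = "measure_pmf.prob (sample_list V d m)"
  have L: "?L \<ge> 1" using assms by simp
  have "real k \<le> real d ^ 1" using assms by simp
  also have "\<dots> \<le> real d ^ 3" using assms by (intro power_increasing) auto
  finally have "1 * 1 \<le> (real d ^ 3 / k) * ?L"
    using L assms by (intro mult_mono) auto
  then have y: "1 \<le> (real d ^ 3 / k) * ?L" by simp
  then have "?x \<ge> 0" by linarith
  then have m: "?x < m" "m \<le> ?x + 1" unfolding m_def by linarith+
  have "3 * (d * ?L) = ?x * (k / (24 * real d ^ 2))"
    using assms by (simp add: field_simps power2_eq_square power3_eq_cube)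
  also have "\<dots> < m * (k / (24 * real d ^ 2))"
    using m assms by (intro mult_strict_right_mono) auto
  finally have lt: "3 * (d * ?L) < m * (k / (24 * real d ^ 2))" .
  have "?P {Ss. \<exists>(u, N, W)\<in>?I. \<forall>S\<in>set Ss. S \<notin> hits u N W} \<le> card ?I * exp (- (m * (k / (24 * real d ^ 2))))"
    using card_configurations(1)[OF assms] assms by (intro prob_sample_list_misses) auto
  also have "\<dots> \<le> exp (3 * (d * ?L)) * exp (- (m * (k / (24 * real d ^ 2))))"
    using card_configurations(2)[OF assms] by (intro mult_right_mono) auto
  also have "\<dots> < 1" using lt by (simp add: exp_add[symmetric])
  finally have "?P {Ss. \<exists>(u, N, W)\<in>?I. \<forall>S\<in>set Ss. S \<notin> hits u N W} \<noteq> 1" by simp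
  then have "\<not> set_pmf (sample_list V d m) \<subseteq> {Ss. \<exists>(u, N, W)\<in>?I. \<forall>S\<in>set Ss. S \<notin> hits u N W}"
    by (subst (asm) measure_pmf.prob_eq_1) (auto simp: AE_measure_pmf_iff)
  then obtain Ss where Ss: "Ss \<in> set_pmf (sample_list V d m)" "splitting V d k Ss"
    unfolding splitting_def case_prod_unfold by blast
  then show ?thesis
    using m y length_sample_list[OF Ss(1)] set_sample_list[OF assms(1) Ss(1)]
    by (intro exI[of _ Ss]) auto
qed

text \<open>Absorbs the summand 1 in \<open>1 + ln x\<close> into a multiple of the
  logarithm.\<close>

lemma one_le_ln:
  fixes x :: real
  assumes "2 \<le> x"
  shows "1 \<le> 3 / 2 * ln x"
proof -
  have "2 / 3 \<le> ln (2::real)" by (rule ln2_ge_two_thirds)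
  also have "\<dots> \<le> ln x" using assms by simp
  finally show ?thesis by simp
qed

subsection \<open>Query bounds\<close>

text \<open>Two estimates of \<open>1 + ln (n / d)\<close>: by \<open>5 / 2 * ln n\<close> for
  sparse graphs, and by \<open>n / d\<close> for graphs so dense that
  \<open>ln (n / \<Delta>)\<close> cannot pay for a factor \<open>ln n\<close>.\<close>

lemma weak_family_exists:
  assumes "finite V" "2 \<le> card V" "1 \<le> d"
  shows "\<exists>Ss. splitting V d d Ss \<and> (\<forall>S\<in>set Ss. S \<subseteq> V) \<and>
    real (length Ss) \<le> 183 * ln (card V) * real d ^ 2 \<and> real (length Ss) \<le> 73 * real (card V) * d"
proof (cases "d \<le> card V")
  case True
  let ?L = "1 + ln (card V / d)"
  from splitting_exists[OF assms(1,3) order_refl True]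
  obtain Ss where Ss: "splitting V d d Ss" "\<forall>S\<in>set Ss. S \<subseteq> V"
    "real (length Ss) \<le> 73 * (real d ^ 3 / d) * ?L" by blast
  have len: "real (length Ss) \<le> 73 * real d ^ 2 * ?L"
    using Ss(3) assms(3) by (simp add: power2_eq_square power3_eq_cube)
  have "?L \<le> 1 + ln (card V)" using assms True by (simp add: ln_div)
  also have "\<dots> \<le> 5 / 2 * ln (card V)" using one_le_ln[of "card V"] assms(2) by simp
  finally have "73 * real d ^ 2 * ?L \<le> 73 * real d ^ 2 * (5 / 2 * ln (card V))"
    by (intro mult_left_mono) auto
  also have "\<dots> = 182.5 * (ln (card V) * real d ^ 2)" by simp
  also have "\<dots> \<le> 183 * (ln (card V) * real d ^ 2)"
    using assms by (intro mult_right_mono mult_nonneg_nonneg) auto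
  finally have 1: "real (length Ss) \<le> 183 * ln (card V) * real d ^ 2" using len by simp
  have "?L \<le> card V / d"
    using ln_le_minus_one[of "card V / d"] assms True by simp
  then have "73 * real d ^ 2 * ?L \<le> 73 * real d ^ 2 * (card V / d)"
    by (intro mult_left_mono) auto
  also have "\<dots> = 73 * real (card V) * d" using assms by (simp add: power2_eq_square)
  finally have "real (length Ss) \<le> 73 * real (card V) * d" using len by simp
  with 1 Ss show ?thesis by blast
next
  case False
  \<comment> \<open>For \<open>d > n\<close> no \<open>W\<close> of size \<open>d\<close> exists,
    and the empty family splits vacuously.\<close>
  have "card W \<noteq> d" if "W \<subseteq> V" for W
    using card_mono[OF assms(1) that] False by simp
  then have "configurations V d d = {}"
    unfolding configurations_def by blast
  then have "splitting V d d []" by (simp add: splitting_def)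
  then show ?thesis using assms by (intro exI[of _ "[]"]) simp
qed

text \<open>
  Querying all pairs when \<open>d > n / 2\<close> is what makes the cubic bound survive \<open>ln (n / \<Delta>)\<close> becoming as
  small as \<open>1 / n\<close>.
\<close>

lemma strong_family_exists:
  assumes "finite V" "2 \<le> card V" "1 \<le> d"
  shows "\<exists>Ss. splitting V d 1 Ss \<and> (\<forall>S\<in>set Ss. S \<subseteq> V) \<and>
    real (length Ss) \<le> (if 2 * d \<le> card V then 183 * real d ^ 3 * ln (card V / d) else real (card V) ^ 2)"
proof (cases "2 * d \<le> card V")
  case True
  let ?L = "ln (card V / d)"
  have "d \<le> card V" using True by simp
  from splitting_exists[OF assms(1) order_refl assms(3) this]
  obtain Ss where Ss: "splitting V d 1 Ss" "\<forall>S\<in>set Ss. S \<subseteq> V"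
    and len: "real (length Ss) \<le> 73 * real d ^ 3 * (1 + ?L)" by auto
  have "real (2 * d) \<le> card V" using True of_nat_le_iff by blast
  then have "2 \<le> card V / d" using assms(3) by (simp add: field_simps)
  then have "1 \<le> 3 / 2 * ?L" by (rule one_le_ln)
  then have "73 * real d ^ 3 * (1 + ?L) \<le> 73 * real d ^ 3 * (183 / 73 * ?L)"
    by (intro mult_left_mono) auto
  then have "real (length Ss) \<le> 183 * real d ^ 3 * ?L" using len by simp
  with Ss True show ?thesis by auto
next
  case False
  let ?P = "(\<lambda>(u, v). {u, v}) ` (V \<times> V)"
  have "finite ?P" using assms(1) by simp
  then obtain Ss where Ss: "set Ss = ?P" "distinct Ss" using finite_distinct_list by blast
  have "length Ss = card ?P" using Ss distinct_card by fastforce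
  also have "\<dots> \<le> card (V \<times> V)" using assms(1) by (intro card_image_le) simp
  also have "\<dots> = card V ^ 2" by (simp add: card_cartesian_product power2_eq_square)
  finally have len: "real (length Ss) \<le> real (card V) ^ 2"
    by (metis of_nat_le_iff of_nat_power)
  have "splitting V d 1 Ss"
    unfolding splitting_def
  proof safe
    fix u N W assume c: "(u, N, W) \<in> configurations V d 1"
    then have "card W = 1" by (simp add: configurations_def)
    then obtain v where W: "W = {v}" by (rule card_1_singletonE)
    then have "u \<in> V" "v \<in> V" "u \<notin> N" "v \<notin> N" using c by (auto simp: configurations_def)
    \<comment> \<open>The pair itself is a hit, because neither of its vertices lies in
      \<open>N\<close>.\<close>
    then have "{u, v} \<in> set Ss" "{u, v} \<in> hits u N W"
      unfolding Ss(1) W hits_def by auto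
    then show "\<exists>S\<in>set Ss. S \<in> hits u N W" by blast
  qed
  moreover have "\<forall>S\<in>set Ss. S \<subseteq> V" using Ss(1) by auto
  ultimately show ?thesis using len False by auto
qed

text \<open>For small \<open>M\<close> or \<open>D\<close> the logarithm \<open>ln (n / M)\<close>
  absorbs the constants. Otherwise \<open>n\<close> is at most a constant times \<open>M\<close>,
  and both costs are of order \<open>M ^ 3 / n\<close>, which \<open>ln (n / M) \<ge> 1 / n\<close>
  turns into the stated bound.\<close>

lemma deterministic_cost:
  fixes n M D :: nat and q h :: real
  assumes n: "2 \<le> n" and M: "1 \<le> M" "M < n" and D: "M \<le> D" "D \<le> 4 * M"
    and q1: "q \<le> 61 * ln n * (16 * real M ^ 2)" and q2: "q \<le> 73 * real n * (4 * real M)"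
    and h: "h \<le> (if 2 * D \<le> n then 183 * real D ^ 3 * ln (n / D) else real n ^ 2)"
  shows "q + h \<le> 15000 * real M ^ 3 * ln (n / M)"
proof -
  let ?L = "ln (n / M)"
  let ?B = "real M ^ 3 * ?L"
  \<comment> \<open>Integrality of \<open>M < n\<close> supplies the gap of 1.\<close>
  have "1 / real n \<le> 1 - M / n"
    using M by (simp add: field_simps)
  also have "\<dots> \<le> - ln (M / n)"
    using ln_le_minus_one[of "M / n"] M by simp
  also have "\<dots> = ?L" using M by (simp add: ln_div)
  finally have L: "1 / real n \<le> ?L" .
  then have B: "real M ^ 3 / n \<le> ?B"
    using mult_left_mono[OF L, of "real M ^ 3"] by simp
  have q: "q \<le> 2440 * ?B"
  proof (cases "2 * M \<le> n")
    case True
    then have "real (2 * M) \<le> n" using of_nat_le_iff by blast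
    then have "2 \<le> n / M" using M by (simp add: field_simps)
    then have "1 \<le> 3 / 2 * ?L" by (rule one_le_ln)
    then have "M * (1 + ?L) \<le> M * (5 / 2 * ?L)" by (intro mult_left_mono) auto
    moreover have "ln n \<le> M * (1 + ?L)"
      using entropy_mono[of 1 M n] M by simp
    ultimately have "ln n \<le> M * (5 / 2 * ?L)" by linarith
    then have "976 * real M ^ 2 * ln n \<le> 976 * real M ^ 2 * (M * (5 / 2 * ?L))"
      by (intro mult_left_mono) auto
    then show ?thesis using q1 by (simp add: power2_eq_square power3_eq_cube mult_ac)
  next
    case False
    then have "real n \<le> 2 * M" by linarith
    then have "real n ^ 2 \<le> (2 * real M) ^ 2" by (intro power_mono) auto
    then have "292 * real M * real n ^ 2 \<le> 292 * real M * (2 * real M) ^ 2"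
      by (intro mult_left_mono) auto
    then have "292 * real M * real n \<le> 1168 * (real M ^ 3 / n)"
      using n by (simp add: field_simps power2_eq_square power3_eq_cube)
    moreover have "0 \<le> real M ^ 3 / n" by simp
    moreover have "q \<le> 292 * real M * real n" using q2 by (simp add: mult_ac)
    ultimately show ?thesis using B by linarith
  qed
  have h': "h \<le> 11712 * ?B"
  proof (cases "2 * D \<le> n")
    case True
    have "real D ^ 3 \<le> (4 * real M) ^ 3" using D by (intro power_mono) auto
    moreover have "ln (n / D) \<le> ?L"
      using D M n by (simp add: frac_le ln_div)
    ultimately have "real D ^ 3 * ln (n / D) \<le> (4 * real M) ^ 3 * ?L"
      using True D M by (intro mult_mono) auto
    then show ?thesis using h True by (simp add: power_mult_distrib)
  next
    case False
    \<comment> \<open>From \<open>n < 2 * D\<close> and \<open>D \<le> 4 * M\<close>; the cube of 8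
      gives the 512 below.\<close>
    then have "real n \<le> 8 * M" using D by linarith
    then have "real n ^ 3 \<le> (8 * real M) ^ 3" by (intro power_mono) auto
    then have "real n ^ 2 \<le> 512 * (real M ^ 3 / n)"
      using n by (simp add: field_simps power2_eq_square power3_eq_cube)
    moreover have "0 \<le> real M ^ 3 / n" by simp
    moreover have "h \<le> real n ^ 2" using h False by simp
    ultimately show ?thesis using B by linarith
  qed
  have "0 \<le> ?B" using B by (meson divide_nonneg_nonneg of_nat_0_le_iff order_trans zero_le_power)
  \<comment> \<open>The constants add up to 2440 + 11712 = 14152.\<close>
  with q h' show ?thesis by simp
qed

text \<open>At most \<open>n ^ 2\<close> ordered non-edges are each missed with probability at most
  \<open>n ^ (-3)\<close>, which leaves \<open>1 / n\<close>. The 72 is again 3 times 24, now with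
  \<open>k = 1\<close>.\<close>

lemma random_family_separates:
  assumes G: "simple_graph V E" and n: "2 \<le> card V" and d: "1 \<le> d" "max_degree V E \<le> d"
    and m: "72 * real d ^ 2 * ln (card V) \<le> m"
  shows "measure_pmf.prob (sample_list V d m) {Ss. candidates V (map (cc_oracle E) Ss) = E}
    \<ge> 1 - inverse (card V)"
proof -
  let ?n = "real (card V)" and ?P = "measure_pmf.prob (sample_list V d m)"
  define I where "I = (\<lambda>(u, v). (u, neighbours E u, {v})) ` {(u, v). u \<in> V \<and> v \<in> V \<and> u \<noteq> v \<and> {u, v} \<notin> E}"
  let ?bad = "{Ss. \<exists>(u, N, W)\<in>I. \<forall>S\<in>set Ss. S \<notin> hits u N W}"
  have V: "finite V" using G by (simp add: simple_graph_def)
  have sub: "{(u, v). u \<in> V \<and> v \<in> V \<and> u \<noteq> v \<and> {u, v} \<notin> E} \<subseteq> V \<times> V" by auto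
  have fin: "finite {(u, v). u \<in> V \<and> v \<in> V \<and> u \<noteq> v \<and> {u, v} \<notin> E}"
    using finite_subset[OF sub] V by simp
  have "card I \<le> card (V \<times> V)"
    unfolding I_def by (rule order_trans[OF card_image_le[OF fin] card_mono[OF finite_cartesian_product[OF V V] sub]])
  then have cardI: "card I \<le> ?n ^ 2"
    by (metis card_cartesian_product of_nat_le_iff of_nat_power power2_eq_square)
  have I: "I \<subseteq> configurations V d 1"
  proof
    fix x assume "x \<in> I"
    then obtain u v where x: "x = (u, neighbours E u, {v})" and uv: "u \<in> V" "v \<in> V" "u \<noteq> v" "{u, v} \<notin> E"
      unfolding I_def by (elim imageE) auto
    have "neighbours E u \<subseteq> V - {u}" by (rule neighbours_subset[OF G])
    moreover have "card (neighbours E u) \<le> d" using max_degree_ge[OF G uv(1)] d by linarith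
    moreover have "v \<notin> neighbours E u" using uv by (simp add: neighbours_def)
    ultimately show "x \<in> configurations V d 1"
      unfolding x configurations_def using uv by auto
  qed
  have "3 * ln ?n = 72 * real d ^ 2 * ln ?n * (1 / (24 * real d ^ 2))"
    using d by simp
  also have "\<dots> \<le> m * (1 / (24 * real d ^ 2))"
    using m by (intro mult_right_mono) auto
  finally have e: "3 * ln ?n \<le> m * (1 / (24 * real d ^ 2))" .
  have "?P ?bad \<le> card I * exp (- (m * (real 1 / (24 * real d ^ 2))))"
    using fin d by (intro prob_sample_list_misses[OF V I]) (auto simp: I_def)
  also have "\<dots> \<le> ?n ^ 2 * exp (- (3 * ln ?n))"
    using cardI e by (intro mult_mono) auto
  also have "exp (- (3 * ln ?n)) = inverse (?n ^ 3)"
    using n by (simp add: exp_minus exp_of_nat_mult[of 3, simplified])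
  also have "?n ^ 2 * inverse (?n ^ 3) = inverse ?n"
    using n by (simp add: field_simps power2_eq_square power3_eq_cube)
  finally have bad: "?P ?bad \<le> inverse ?n" .
  have "- ?bad \<subseteq> {Ss. candidates V (map (cc_oracle E) Ss) = E}"
  proof
    fix Ss assume Ss: "Ss \<in> - ?bad"
    have "candidates V (map (cc_oracle E) Ss) = E"
    proof (rule candidates_eq_edges[OF G])
      fix u v assume "u \<in> V" "v \<in> V" "u \<noteq> v" "{u, v} \<notin> E"
      then have "(u, neighbours E u, {v}) \<in> I"
        unfolding I_def by (intro image_eqI[of _ _ "(u, v)"]) simp_all
      then show "\<exists>S\<in>set Ss. S \<in> hits u (neighbours E u) {v}" using Ss by auto
    qed
    then show "Ss \<in> {Ss. candidates V (map (cc_oracle E) Ss) = E}" by simp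
  qed
  then have "?P (- ?bad) \<le> ?P {Ss. candidates V (map (cc_oracle E) Ss) = E}"
    by (intro measure_pmf.finite_measure_mono) auto
  moreover have "?P (- ?bad) = 1 - ?P ?bad"
    using measure_pmf.prob_compl[of ?bad "sample_list V d m"] by (simp add: Compl_eq_Diff_UNIV)
  ultimately show ?thesis using bad by linarith
qed

section \<open>The two algorithms and their analysis\<close>

lemma graph_on_small_vertex_set:
  assumes "simple_graph V E" "card V < 2"
  shows "E = {}"
proof (rule ccontr)
  assume "E \<noteq> {}"
  then obtain e where "e \<subseteq> V" "card e = 2" "finite V" using assms(1) by (auto simp: simple_graph_def)
  then show False using card_mono[of V e] assms(2) by simp
qed

text \<open>\<open>F\<close> serves the degree search and \<open>H\<close> the final round. On a
  single vertex both query bounds are 0, so no query may be made.\<close>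

definition reconstruct :: "'a set \<Rightarrow> (nat \<Rightarrow> 'a set list) \<Rightarrow> (nat \<Rightarrow> 'a set list) \<Rightarrow> 'a cc_algorithm" where
  "reconstruct V F H = (if card V < 2 then Output {}
     else estimate V F (card V) 1 (\<lambda>D. ask (H D) (\<lambda>Ps. Output (candidates V Ps))))"

definition weak_family :: "'a set \<Rightarrow> nat \<Rightarrow> 'a set list" where
  "weak_family V d = (SOME Ss. splitting V d d Ss \<and> (\<forall>S\<in>set Ss. S \<subseteq> V) \<and>
    real (length Ss) \<le> 183 * ln (card V) * real d ^ 2 \<and> real (length Ss) \<le> 73 * real (card V) * d)"

definition strong_family :: "'a set \<Rightarrow> nat \<Rightarrow> 'a set list" where
  "strong_family V d = (SOME Ss. splitting V d 1 Ss \<and> (\<forall>S\<in>set Ss. S \<subseteq> V) \<and>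
    real (length Ss) \<le> (if 2 * d \<le> card V then 183 * real d ^ 3 * ln (card V / d) else real (card V) ^ 2))"

text \<open>\<open>D\<close> and \<open>Q\<close> are fixed before \<open>H\<close> is, so a random
  \<open>H\<close> influences the run only through its value at \<open>D\<close>. The 61 is 183 /
  3.\<close>

lemma reconstruct_run:
  assumes G: "simple_graph V E" "V \<noteq> {}" and n: "2 \<le> card V"
  defines "M \<equiv> max 1 (max_degree V E)"
  obtains D Q where "M \<le> D" "D \<le> 4 * M" "\<forall>S\<in>set Q. S \<subseteq> V"
    "real (length Q) \<le> 61 * ln (card V) * (16 * real M ^ 2)" "real (length Q) \<le> 73 * real (card V) * (4 * real M)"
    "\<And>H. result E (reconstruct V (weak_family V) H) = candidates V (map (cc_oracle E) (H D))"
    "\<And>H. queries E (reconstruct V (weak_family V) H) = Q @ H D"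
proof -
  have fin: "finite V" using G by (simp add: simple_graph_def)
  have ln: "0 \<le> ln (card V)" using n by simp
  have F: "splitting V d d (weak_family V d) \<and> (\<forall>S\<in>set (weak_family V d). S \<subseteq> V) \<and>
    real (length (weak_family V d)) \<le> 183 * ln (card V) * real d ^ 2 \<and>
    real (length (weak_family V d)) \<le> 73 * real (card V) * real d" if "d \<ge> 1" for d
    unfolding weak_family_def by (rule someI_ex[OF weak_family_exists[OF fin n that]])
  have "M \<le> card V"
    using max_degree_less_card[OF G] n unfolding M_def by linarith
  \<comment> \<open>Fuel \<open>card V\<close> suffices when the search starts at
    \<open>d = 1\<close>.\<close>
  then have "M \<le> 2 ^ card V * 1"
    using less_exp[of "card V"] by linarith
  moreover have "1 \<le> 2 * M" unfolding M_def by linarith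
  ultimately have "\<exists>D Q. M \<le> D \<and> D \<le> 4 * M \<and> (\<forall>S\<in>set Q. S \<subseteq> V) \<and>
    real (length Q) \<le> 183 * ln (card V) * (16 * real M ^ 2 - real 1 ^ 2) / 3 \<and>
    real (length Q) \<le> 73 * real (card V) * (4 * real M - real 1) \<and>
    (\<forall>K. result E (estimate V (weak_family V) (card V) 1 K) = result E (K D) \<and>
      queries E (estimate V (weak_family V) (card V) 1 K) = Q @ queries E (K D))"
  proof (intro estimate_correct[OF G F])
    show "0 \<le> 183 * ln (card V)" using ln by simp
    show "M = max 1 (max_degree V E)" by (simp add: M_def)
  qed simp_all
  then obtain D Q where DQ: "M \<le> D" "D \<le> 4 * M" "\<forall>S\<in>set Q. S \<subseteq> V"
    and len: "real (length Q) \<le> 183 * ln (card V) * (16 * real M ^ 2 - real 1 ^ 2) / 3"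
      "real (length Q) \<le> 73 * real (card V) * (4 * real M - real 1)"
    and run: "\<And>K. result E (estimate V (weak_family V) (card V) 1 K) = result E (K D)"
      "\<And>K. queries E (estimate V (weak_family V) (card V) 1 K) = Q @ queries E (K D)"
    by blast
  have "61 * ln (card V) * (16 * real M ^ 2 - 1) \<le> 61 * ln (card V) * (16 * real M ^ 2)"
    using ln by (intro mult_left_mono) auto
  then have 1: "real (length Q) \<le> 61 * ln (card V) * (16 * real M ^ 2)" using len(1) by simp
  have "73 * real (card V) * (4 * real M - real 1) \<le> 73 * real (card V) * (4 * real M)"
    by (intro mult_left_mono) auto
  with len(2) have 2: "real (length Q) \<le> 73 * real (card V) * (4 * real M)" by (rule order_trans)
  show thesis
    by (rule that[OF DQ 1 2]) (use n run in \<open>simp_all add: reconstruct_def result_ask queries_ask\<close>)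
qed

lemma deterministic_reconstruction:
  assumes G: "simple_graph V E" "V \<noteq> {}"
  defines "T \<equiv> reconstruct V (weak_family V) (strong_family V)"
  shows "(\<forall>S\<in>set (queries E T). S \<subseteq> V) \<and>
    real (length (queries E T)) \<le> 15000 * degree_param V E ^ 3 * ln (card V / degree_param V E) \<and>
    result E T = E"
proof (cases "card V < 2")
  case True
  then have "E = {}" using graph_on_small_vertex_set[OF G(1)] by simp
  moreover have "card V = 1"
    using True G by (simp add: simple_graph_def less_2_cases_iff)
  moreover from this have "degree_param V E = 1"
    using max_degree_less_card[OF G] by (simp add: degree_param_def)
  ultimately show ?thesis by (simp add: T_def reconstruct_def)
next
  case False
  then have n: "2 \<le> card V" by simp
  have fin: "finite V" using G by (simp add: simple_graph_def)
  define M where "M = max 1 (max_degree V E)"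
  have M: "1 \<le> M" "M < card V" "max_degree V E \<le> M" "degree_param V E = M"
    using max_degree_less_card[OF G] n by (auto simp: M_def degree_param_def)
  obtain D Q where DQ: "M \<le> D" "D \<le> 4 * M" "\<forall>S\<in>set Q. S \<subseteq> V"
    and len: "real (length Q) \<le> 61 * ln (card V) * (16 * real M ^ 2)"
      "real (length Q) \<le> 73 * real (card V) * (4 * real M)"
    and run: "\<And>H. result E (reconstruct V (weak_family V) H) = candidates V (map (cc_oracle E) (H D))"
      "\<And>H. queries E (reconstruct V (weak_family V) H) = Q @ H D"
    by (rule reconstruct_run[OF G n, folded M_def]) (rule that)
  have D: "1 \<le> D" "max_degree V E \<le> D" using DQ M by linarith+
  have H: "splitting V D 1 (strong_family V D)" "\<forall>S\<in>set (strong_family V D). S \<subseteq> V"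
    "real (length (strong_family V D)) \<le>
      (if 2 * D \<le> card V then 183 * real D ^ 3 * ln (card V / D) else real (card V) ^ 2)"
    using someI_ex[OF strong_family_exists[OF fin n D(1)], folded strong_family_def] by blast+
  have "result E T = E"
    unfolding T_def run by (rule splitting_one_candidates[OF G(1) H(1) D(2)])
  moreover have "real (length (queries E T)) \<le> 15000 * real M ^ 3 * ln (card V / M)"
    unfolding T_def run length_append of_nat_add
    by (rule deterministic_cost[OF n M(1,2) DQ(1,2) len H(3)])
  moreover have "\<forall>S\<in>set (queries E T). S \<subseteq> V"
    unfolding T_def run set_append using DQ(3) H(2) by blast
  ultimately show ?thesis unfolding M(4) by blast
qed

text \<open>
  A randomized algorithm is a distribution over deterministic trees, so the final round is sampled in
  advance for every degree bound \<open>D\<close>. The bound actually reached depends only on the graph, which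
  leaves a single marginal to analyse.
\<close>

definition random_families :: "'a set \<Rightarrow> (nat \<Rightarrow> 'a set list) pmf" where
  "random_families V = Pi_pmf {..4 * card V} []
     (\<lambda>d. sample_list V d (nat \<lceil>72 * real d ^ 2 * ln (card V)\<rceil>))"

definition randomized_algorithm :: "'a set \<Rightarrow> 'a cc_algorithm pmf" where
  "randomized_algorithm V = map_pmf (reconstruct V (weak_family V)) (random_families V)"

lemma randomized_reconstruction:
  assumes G: "simple_graph V E" "V \<noteq> {}"
  shows "(\<forall>T\<in>set_pmf (randomized_algorithm V). (\<forall>S\<in>set (queries E T). S \<subseteq> V) \<and>
      real (length (queries E T)) \<le> 2200 * degree_param V E ^ 2 * ln (card V)) \<and>
    measure_pmf.prob (randomized_algorithm V) {T. result E T = E} \<ge> 1 - inverse (card V)"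
proof (cases "card V < 2")
  case True
  then have "E = {}" using graph_on_small_vertex_set[OF G(1)] by simp
  moreover have "card V = 1"
    using True G by (simp add: simple_graph_def less_2_cases_iff)
  ultimately show ?thesis
    by (auto simp: randomized_algorithm_def reconstruct_def)
next
  case False
  then have n: "2 \<le> card V" by simp
  have fin: "finite V" using G by (simp add: simple_graph_def)
  define M where "M = max 1 (max_degree V E)"
  have M: "1 \<le> M" "M < card V" "max_degree V E \<le> M" "degree_param V E = M"
    using max_degree_less_card[OF G] n by (auto simp: M_def degree_param_def)
  obtain D Q where DQ: "M \<le> D" "D \<le> 4 * M" "\<forall>S\<in>set Q. S \<subseteq> V"
    and len: "real (length Q) \<le> 61 * ln (card V) * (16 * real M ^ 2)"
      "real (length Q) \<le> 73 * real (card V) * (4 * real M)"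
    and run: "\<And>H. result E (reconstruct V (weak_family V) H) = candidates V (map (cc_oracle E) (H D))"
      "\<And>H. queries E (reconstruct V (weak_family V) H) = Q @ H D"
    by (rule reconstruct_run[OF G n, folded M_def]) (rule that)
  \<comment> \<open>\<open>D \<le> 4 * M\<close> and \<open>M < n\<close> place \<open>D\<close> in
    the range for which final rounds were sampled.\<close>
  have D: "1 \<le> D" "max_degree V E \<le> D" "D \<in> {..4 * card V}" using DQ M by auto
  define m where "m = nat \<lceil>72 * real D ^ 2 * ln (card V)\<rceil>"
  have lnV: "0 \<le> ln (card V)" using n by simp
  have m: "72 * real D ^ 2 * ln (card V) \<le> m"
    unfolding m_def by (rule of_nat_ceiling)
  have "real D ^ 2 \<le> (4 * real M) ^ 2" using DQ(2) by (intro power_mono) auto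
  then have "72 * real D ^ 2 * ln (card V) \<le> 72 * (4 * real M) ^ 2 * ln (card V)"
    using lnV by (intro mult_right_mono mult_left_mono) auto
  moreover have "m \<le> 72 * real D ^ 2 * ln (card V) + 1"
  proof -
    have "0 \<le> 72 * real D ^ 2 * ln (card V)" using lnV by simp
    then show ?thesis unfolding m_def by linarith
  qed
  moreover have "1 \<le> real M ^ 2 * (3 / 2 * ln (card V))"
    using mult_mono[of 1 "real M ^ 2" 1 "3 / 2 * ln (card V)"] one_le_ln[of "card V"] n M(1) by simp
  \<comment> \<open>The search contributes 61 * 16 = 976, the final round 72 * 16 = 1152, and
    rounding \<open>m\<close> up 3 / 2.\<close>
  ultimately have cost: "length Q + m \<le> 2200 * real M ^ 2 * ln (card V)"
    using len(1) lnV by (simp add: power_mult_distrib mult_ac)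
  have comp: "map_pmf (\<lambda>H. H D) (random_families V) = sample_list V D m"
    unfolding random_families_def m_def using D(3) by (subst Pi_pmf_component) auto
  have "(\<forall>S\<in>set (queries E T). S \<subseteq> V) \<and>
      real (length (queries E T)) \<le> 2200 * degree_param V E ^ 2 * ln (card V)"
    if T: "T \<in> set_pmf (randomized_algorithm V)" for T
  proof -
    obtain H where H: "H \<in> set_pmf (random_families V)" "T = reconstruct V (weak_family V) H"
      using T unfolding randomized_algorithm_def set_map_pmf by blast
    have HD: "H D \<in> set_pmf (sample_list V D m)"
      unfolding comp[symmetric] using H(1) by simp
    have "\<forall>S\<in>set (queries E T). S \<subseteq> V"
      unfolding H(2) run set_append using DQ(3) set_sample_list[OF fin HD] by blast
    moreover have "real (length (queries E T)) \<le> 2200 * real M ^ 2 * ln (card V)"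
      using cost length_sample_list[OF HD] by (simp add: H(2) run)
    ultimately show ?thesis unfolding M(4) by blast
  qed
  moreover have "measure_pmf.prob (randomized_algorithm V) {T. result E T = E}
    = measure_pmf.prob (sample_list V D m) {Ss. candidates V (map (cc_oracle E) Ss) = E}"
    unfolding comp[symmetric] by (simp add: randomized_algorithm_def run)
  ultimately show ?thesis
    using random_family_separates[OF G(1) n D(1,2) m] by simp
qed

theorem theorem4:
  "(\<exists>(R :: nat set \<Rightarrow> nat cc_algorithm pmf) (C :: real) (\<delta> :: nat \<Rightarrow> real).
      \<delta> \<longlonglongrightarrow> 0 \<and>
      (\<forall>V E. V \<noteq> {} \<and> simple_graph V E \<longrightarrow>
        (\<forall>T \<in> set_pmf (R V).
            (\<forall>S \<in> set (queries E T). S \<subseteq> V) \<and>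
            real (length (queries E T)) \<le> C * degree_param V E ^ 2 * ln (real (card V))) \<and>
        measure_pmf.prob (R V) {T. result E T = E} \<ge> 1 - \<delta> (card V)))
   \<and>
   (\<exists>(D :: nat set \<Rightarrow> nat cc_algorithm) (C :: real).
      \<forall>V E. V \<noteq> {} \<and> simple_graph V E \<longrightarrow>
        (\<forall>S \<in> set (queries E (D V)). S \<subseteq> V) \<and>
        real (length (queries E (D V)))
          \<le> C * degree_param V E ^ 3 * ln (real (card V) / degree_param V E) \<and>
        result E (D V) = E)"
proof (intro conjI)
  show "\<exists>(R :: nat set \<Rightarrow> nat cc_algorithm pmf) (C :: real) (\<delta> :: nat \<Rightarrow> real).
      \<delta> \<longlonglongrightarrow> 0 \<and>
      (\<forall>V E. V \<noteq> {} \<and> simple_graph V E \<longrightarrow>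
        (\<forall>T \<in> set_pmf (R V).
            (\<forall>S \<in> set (queries E T). S \<subseteq> V) \<and>
            real (length (queries E T)) \<le> C * degree_param V E ^ 2 * ln (real (card V))) \<and>
        measure_pmf.prob (R V) {T. result E T = E} \<ge> 1 - \<delta> (card V))"
    using randomized_reconstruction lim_inverse_n
    by (intro exI[of _ randomized_algorithm] exI[of _ 2200] exI[of _ "\<lambda>n. inverse (real n)"]) blast
  show "\<exists>(D :: nat set \<Rightarrow> nat cc_algorithm) (C :: real).
      \<forall>V E. V \<noteq> {} \<and> simple_graph V E \<longrightarrow>
        (\<forall>S \<in> set (queries E (D V)). S \<subseteq> V) \<and>
        real (length (queries E (D V)))
          \<le> C * degree_param V E ^ 3 * ln (real (card V) / degree_param V E) \<and>
        result E (D V) = E"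
    using deterministic_reconstruction
    by (intro exI[of _ "\<lambda>V. reconstruct V (weak_family V) (strong_family V)"] exI[of _ 15000]) blast
qed

end
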